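(* Let $d\geq 3$ and $n\geq 1$ be integers. There exists a perfect acyclic matching on $\mathrm{Ind}_{d-2}(P_n)$ such that: if $n=dk$ or $n=dk-1$ for some integer $k\geq 1$, then its only critical cell is $\bigsqcup_{i=0}^{k-1}\{di+2,di+3,\dots,di+d-1\}$; and for all other values of $n$ it has no critical cells.
   Context: $P_n$ is the path graph with vertex set $\{1,\dots,n\}$ and edges $(i,i+1)$ for $1\le i\le n-1$. For a graph $G$ and an integer $r\geq 1$, a subset $I\subseteq V(G)$ is $r$-independent if every connected component of the induced subgraph $G[I]$ has at most $r$ vertices; the $r$-independence complex $\mathrm{Ind}_r(G)$ is the simplicial complex on vertex set $V(G)$ whose simplices are all $r$-independent subsets of $V(G)$. A matching on a simplicial complex $\mathcal{K}$ means a matching on its face poset (all simplices, including $\emptyset$, ordered by inclusion). A partial matching on a poset $P$ is a set $\mathcal{M}\subseteq P\times P$ such that $(a,b)\in\mathcal{M}$ implies that $b$ covers $a$ (that is, $a<b$ and no $c$ satisfies $a<c<b$), and each element of $P$ belongs to at most one pair in $\mathcal{M}$. Write $\mu(a)=b$ for $(a,b)\in\mathcal{M}$. The matching is acyclic if there is no cycle $\mu(a_1)\succ a_1\prec\mu(a_2)\succ a_2\prec\cdots\prec\mu(a_t)\succ a_t\prec\mu(a_1)$ with $t\geq 2$ and $a_1,\dots,a_t$ distinct, where $\prec$ denotes the covering relation. Elements of $P$ not belonging to any pair of the matching are called critical (critical cells). An acyclic matching on a simplicial complex is perfect if all critical cells are homology cells, i.e. the number of critical cells in each dimension equals the rank of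 the reduced homology group in that dimension. *)

theory Defs
  imports
    "Graph_Theory.Graph_Theory"
    "HOL-Algebra.Free_Abelian_Groups"
    "HOL-Library.Extended_Nat"
begin

section \<open>Graphs and higher independence complexes\<close>

text \<open>Undirected graphs are symmetric digraphs; each edge is present in both orientations.\<close>

definition path_graph :: "nat \<Rightarrow> nat pair_pre_digraph" where
  "path_graph n = \<lparr> pverts = {1..n},
     parcs = {(i, j). i \<in> {1..n} \<and> j \<in> {1..n} \<and> (j = i + 1 \<or> i = j + 1)} \<rparr>"

lemma pair_graph_path_graph: "pair_graph (path_graph n)"
proof -
  have "finite (parcs (path_graph n))"
    by (rule finite_subset[of _ "{1..n} \<times> {1..n}"]) (auto simp: path_graph_def)
  then show ?thesis
    by unfold_locales (auto simp: path_graph_def symmetric_def arcs_ends_def arc_to_ends_def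
        with_proj_def intro!: symI)
qed

text \<open>In a symmetric digraph the strongly connected components are exactly the
  connected components of the underlying undirected graph.\<close>

definition r_independent :: "nat \<Rightarrow> 'a pair_pre_digraph \<Rightarrow> 'a set \<Rightarrow> bool" where
  "r_independent r G I \<longleftrightarrow> I \<subseteq> pverts G \<and>
     (\<forall>H \<in> pre_digraph.sccs (with_proj G \<restriction> I). finite (verts H) \<and> card (verts H) \<le> r)"

definition Ind :: "nat \<Rightarrow> 'a pair_pre_digraph \<Rightarrow> 'a set set" where
  "Ind r G = {I. r_independent r G I}"


section \<open>Acyclic matchings on posets\<close>

text \<open>A poset is a subset \<open>P\<close> of an ordered type; for the face poset of a simplicial complex
  (a set of finite sets containing the empty simplex) the order is inclusion.\<close>

definition covered_in :: "'a::order set \<Rightarrow> 'a \<Rightarrow> 'a \<Rightarrow> bool" where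
  "covered_in P a b \<longleftrightarrow> a \<in> P \<and> b \<in> P \<and> a < b \<and> \<not> (\<exists>c \<in> P. a < c \<and> c < b)"

definition partial_matching :: "'a::order set \<Rightarrow> ('a \<times> 'a) set \<Rightarrow> bool" where
  "partial_matching P M \<longleftrightarrow> M \<subseteq> P \<times> P \<and>
     (\<forall>(a, b) \<in> M. covered_in P a b) \<and>
     (\<forall>x \<in> P. \<forall>e \<in> M. \<forall>e' \<in> M. x \<in> {fst e, snd e} \<longrightarrow> x \<in> {fst e', snd e'} \<longrightarrow> e = e')"

text \<open>Only meaningful for \<open>a\<close> in the domain of the matching \<open>M\<close>.\<close>

definition partner :: "('a \<times> 'a) set \<Rightarrow> 'a \<Rightarrow> 'a" where
  "partner M a = (THE b. (a, b) \<in> M)"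

text \<open>A list \<open>[a\<^sub>1, \<dots>, a\<^sub>t]\<close> encodes the cycle
  \<open>\<mu>(a\<^sub>1) \<succ> a\<^sub>1 \<prec> \<mu>(a\<^sub>2) \<succ> a\<^sub>2 \<prec> \<dots> \<prec> \<mu>(a\<^sub>t) \<succ> a\<^sub>t \<prec> \<mu>(a\<^sub>1)\<close>.\<close>

definition matching_cycle :: "'a::order set \<Rightarrow> ('a \<times> 'a) set \<Rightarrow> 'a list \<Rightarrow> bool" where
  "matching_cycle P M as \<longleftrightarrow> length as \<ge> 2 \<and> distinct as \<and> set as \<subseteq> Domain M \<and>
     (\<forall>i < length as. covered_in P (as ! i) (partner M (as ! i)) \<and>
        covered_in P (as ! i) (partner M (as ! (Suc i mod length as))))"

definition acyclic_matching :: "'a::order set \<Rightarrow> ('a \<times> 'a) set \<Rightarrow> bool" where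
  "acyclic_matching P M \<longleftrightarrow> partial_matching P M \<and> \<not> (\<exists>as. matching_cycle P M as)"

definition critical :: "'a set \<Rightarrow> ('a \<times> 'a) set \<Rightarrow> 'a set" where
  "critical P M = {x \<in> P. \<forall>(a, b) \<in> M. x \<noteq> a \<and> x \<noteq> b}"


section \<open>Reduced simplicial homology and its rank\<close>

text \<open>Dimensions are integers, since the empty simplex has dimension \<open>-1\<close>.\<close>

definition simplices :: "'a set set \<Rightarrow> int \<Rightarrow> 'a set set" where
  "simplices K p = {s \<in> K. finite s \<and> int (card s) = p + 1}"

definition simplicial_chain_group :: "'a set set \<Rightarrow> int \<Rightarrow> ('a set \<Rightarrow>\<^sub>0 int) monoid" where
  "simplicial_chain_group K p = free_Abelian_group (simplices K p)"

text \<open>Simplices are oriented by the order of the vertices, so omitting a vertex \<open>v\<close> carries the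
  sign \<open>(-1) ^ i\<close> with \<open>i\<close> the number of smaller vertices. A vertex is mapped to the
  generator of the empty simplex, i.e. the boundary includes the augmentation.\<close>

definition simplicial_boundary :: "('a::linorder set \<Rightarrow>\<^sub>0 int) \<Rightarrow> ('a set \<Rightarrow>\<^sub>0 int)" where
  "simplicial_boundary =
     frag_extend (\<lambda>s. \<Sum>v \<in> s. frag_cmul ((-1) ^ card {u \<in> s. u < v}) (frag_of (s - {v})))"

definition simplicial_cycles :: "'a::linorder set set \<Rightarrow> int \<Rightarrow> ('a set \<Rightarrow>\<^sub>0 int) set" where
  "simplicial_cycles K p = {c \<in> carrier (simplicial_chain_group K p). simplicial_boundary c = 0}"

definition simplicial_boundaries :: "'a::linorder set set \<Rightarrow> int \<Rightarrow> ('a set \<Rightarrow>\<^sub>0 int) set" where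
  "simplicial_boundaries K p = simplicial_boundary ` carrier (simplicial_chain_group K (p + 1))"

definition reduced_simplicial_homology ::
  "'a::linorder set set \<Rightarrow> int \<Rightarrow> ('a set \<Rightarrow>\<^sub>0 int) set monoid" where
  "reduced_simplicial_homology K p =
     subgroup_generated (simplicial_chain_group K p) (simplicial_cycles K p)
       Mod simplicial_boundaries K p"

text \<open>The rank of an abelian group is the supremum of the sizes of its finite
  \<open>\<int>\<close>-linearly independent subsets.\<close>

definition int_independent :: "('a, 'm) monoid_scheme \<Rightarrow> 'a set \<Rightarrow> bool" where
  "int_independent G S \<longleftrightarrow>
     (\<forall>c :: 'a \<Rightarrow> int. finprod G (\<lambda>x. x [^]\<^bsub>G\<^esub> c x) S = \<one>\<^bsub>G\<^esub> \<longrightarrow> (\<forall>x \<in> S. c x = 0))"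

definition abelian_rank :: "('a, 'm) monoid_scheme \<Rightarrow> enat" where
  "abelian_rank G =
     (SUP S \<in> {S. finite S \<and> S \<subseteq> carrier G \<and> int_independent G S}. enat (card S))"


section \<open>Perfect acyclic matchings\<close>

definition perfect_acyclic_matching ::
  "'a::linorder set set \<Rightarrow> ('a set \<times> 'a set) set \<Rightarrow> bool" where
  "perfect_acyclic_matching K M \<longleftrightarrow> acyclic_matching K M \<and>
     (\<forall>p. finite (simplices (critical K M) p) \<and>
        enat (card (simplices (critical K M) p)) =
          abelian_rank (reduced_simplicial_homology K p))"

end

theory Submission
  imports Defs
begin

text \<open>Write $K = \mathrm{Ind}_{d-2}(P_n)$. A set of vertices of a path is $(d-2)$-independent iff it
  contains no run of $d-1$ consecutive vertices, so $K$ consists of the subsets of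
  $\{1,\dots,n\}$ without such a run.

  The matching toggles the vertices $1, d+1, 2d+1, \dots$ in this order: a face $a$ is matched with
  $a$ with $di+1$ added or removed, for the first $i$ such that adding $di+1$ to $a$ stays in $K$.
  Adding $1$ fails only if $\{2,\dots,d-1\} \subseteq a$; then $1, d \notin a$, and the situation at
  $d+1$ is the one at $1$ shifted by $d$. Hence the vertices up to $di$ of a face whose first $i$
  attempts fail are exactly the blocks $\{dj+2,\dots,dj+d-1\}$ with $j < i$. A critical face
  fails at every $i$, so it consists of blocks only, and its last block has to end at $n$ or
  $n-1$; this leaves no critical face unless $n = dk$ or $n = dk-1$, and then exactly one
  (\<open>critical_eq\<close>, \<open>critical_empty\<close>). The number $i$ of the toggled vertex decreases strictly
  along every gradient path, which gives acyclicity.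

  Perfection is a statement about homology, but with at most one critical face only a small part of
  discrete Morse theory is involved. If an acyclic matching of a complex has no critical face, then
  every cycle bounds: subtracting boundaries of upper faces removes all lower faces from a cycle
  (\<open>homologous_to_chain_without_lower_cells\<close>), and a cycle made of upper faces is zero
  (\<open>cycle_on_upper_cells_eq_0\<close>). Suppose now that there is a single critical face $\sigma$ and
  that $\sigma$ is a facet, as it is here. Removing $\sigma$ leaves a complex in which all cycles
  bound, in particular $\partial\sigma = \partial e$ with $e$ avoiding $\sigma$. The cycle
  $z = \sigma - e$ then generates the homology in the dimension of $\sigma$, and no nonzero
  multiple of it bounds, because no face lies above $\sigma$. So this homology group is infinite
  cyclic, and all the others vanish (\<open>perfect_if_critical_facet\<close>).\<close>

section \<open>Higher independence complexes of paths\<close>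

lemma with_proj_path_graph_adj:
  "u \<rightarrow>\<^bsub>with_proj (path_graph n) \<restriction> I\<^esub> v \<longleftrightarrow>
     u \<in> I \<and> v \<in> I \<and> u \<in> {1..n} \<and> v \<in> {1..n} \<and> (v = u + 1 \<or> u = v + 1)"
  by (auto simp: arcs_ends_conv path_graph_def image_iff)

text \<open>Components of an induced subgraph of a path are intervals: a walk moves in unit steps, so it visits
  every vertex between its endpoints. Hence a component with more than \<open>r\<close> vertices is a run of
  length at least \<open>r + 1\<close>, and conversely a run lies in one component.\<close>

lemma in_Ind_path_graph_iff:
  "I \<in> Ind r (path_graph n) \<longleftrightarrow> I \<subseteq> {1..n} \<and> (\<nexists>x. {x..x + r} \<subseteq> I)"
proof (cases "I \<subseteq> {1..n}")
  case False
  then show ?thesis by (auto simp: Ind_def r_independent_def path_graph_def)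
next
  case True
  let ?G = "with_proj (path_graph n) \<restriction> I"
  interpret P: pair_graph "path_graph n" by (rule pair_graph_path_graph)
  interpret G: sym_digraph ?G
    using True by (intro P.induced_graph_imp_graph P.induced_induce) (simp add: path_graph_def)
  have adj: "u \<rightarrow>\<^bsub>?G\<^esub> v \<longleftrightarrow> u \<in> I \<and> v \<in> I \<and> (v = u + 1 \<or> u = v + 1)" for u v
    unfolding with_proj_path_graph_adj using True by blast
  have fin: "finite I" using True finite_subset by blast
  have between: "{u..v} \<subseteq> I" if "u \<rightarrow>\<^sup>*\<^bsub>?G\<^esub> v" for u v
    using that
  proof (induction rule: G.reachable_induct)
    case base
    then show ?case by simp
  next
    case (step v w)
    then have "v \<in> I" "w \<in> I" "w = v + 1 \<or> v = w + 1" by (auto simp: adj)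
    with step.IH show ?case by (auto simp: le_Suc_eq)
  qed
  have r_ind: "r_independent r (path_graph n) I \<longleftrightarrow> (\<forall>H\<in>G.sccs. finite (verts H) \<and> card (verts H) \<le> r)"
    using True by (simp add: r_independent_def path_graph_def)
  have "r_independent r (path_graph n) I \<longleftrightarrow> (\<nexists>x. {x..x + r} \<subseteq> I)"
  proof
    assume *: "r_independent r (path_graph n) I"
    show "\<nexists>x. {x..x + r} \<subseteq> I"
    proof
      assume "\<exists>x. {x..x + r} \<subseteq> I"
      then obtain x where x: "{x..x + r} \<subseteq> I" ..
      have reach: "x \<rightarrow>\<^sup>*\<^bsub>?G\<^esub> (x + j)" if "j \<le> r" for j
        using that
      proof (induction j)
        case 0
        have "x \<in> {x..x + r}" by simp
        with x have "x \<in> I" by blast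
        then show ?case by simp
      next
        case (Suc j)
        then have "x + j \<in> I" "x + j + 1 \<in> I" using x by auto
        then have "(x + j) \<rightarrow>\<^bsub>?G\<^esub> (x + j + 1)" by (simp add: adj)
        with Suc show ?case by (auto intro: G.reachable_adj_trans)
      qed
      let ?S = "{v. x \<rightarrow>\<^sup>*\<^bsub>?G\<^esub> v}"
      have "?G \<restriction> ?S \<in> G.sccs"
        using x by (intro G.induce_reachable_is_in_sccs) auto
      with * have S: "finite ?S" "card ?S \<le> r" by (auto simp: r_ind)
      have "{x..x + r} \<subseteq> ?S"
        using reach by (metis (mono_tags, lifting) atLeastAtMost_iff le_Suc_ex mem_Collect_eq
            nat_add_left_cancel_le subsetI)
      from card_mono[OF S(1) this] S(2) show False by simp
    qed
  next
    assume no_run: "\<nexists>x. {x..x + r} \<subseteq> I"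
    show "r_independent r (path_graph n) I"
      unfolding r_ind
    proof
      fix H assume "H \<in> G.sccs"
      let ?S = "verts H"
      have "?S \<in> G.sccs_verts" using \<open>H \<in> G.sccs\<close> by (simp add: G.in_sccs_vertsI_sccs)
      then have ne: "?S \<noteq> {}" and reach: "\<And>u v. u \<in> ?S \<Longrightarrow> v \<in> ?S \<Longrightarrow> u \<rightarrow>\<^sup>*\<^bsub>?G\<^esub> v"
        by (auto simp: G.in_sccs_verts_conv_reachable)
      have "?S \<subseteq> I" using G.sccs_verts_subsets[OF \<open>?S \<in> G.sccs_verts\<close>] by simp
      then have finS: "finite ?S" using fin finite_subset by blast
      have run: "{Min ?S..Max ?S} \<subseteq> I"
        using between reach finS ne by simp
      have "?S \<subseteq> {Min ?S..Max ?S}" using finS by auto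
      then have "card ?S \<le> Suc (Max ?S) - Min ?S"
        using card_mono[of "{Min ?S..Max ?S}" ?S] by simp
      moreover have "Max ?S < Min ?S + r"
      proof (rule ccontr)
        assume "\<not> Max ?S < Min ?S + r"
        then have "{Min ?S..Min ?S + r} \<subseteq> I" using run by auto
        with no_run show False by blast
      qed
      ultimately show "finite ?S \<and> card ?S \<le> r" using finS by linarith
    qed
  qed
  with True show ?thesis by (simp add: Ind_def)
qed


section \<open>Ranks of abelian groups\<close>

lemma abelian_rank_trivial:
  assumes "comm_group G" and "carrier G = {\<one>\<^bsub>G\<^esub>}"
  shows "abelian_rank G = 0"
proof -
  interpret comm_group G by fact
  have "S = {}" if S: "S \<subseteq> carrier G" "int_independent G S" for S
  proof (rule ccontr)
    assume "S \<noteq> {}"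
    then have "S = {\<one>\<^bsub>G\<^esub>}" using S assms(2) by auto
    have "finprod G (\<lambda>x. x [^]\<^bsub>G\<^esub> (1::int)) S = \<one>\<^bsub>G\<^esub>"
      by (rule finprod_one_eqI) (use \<open>S = {\<one>\<^bsub>G\<^esub>}\<close> in simp)
    then have "\<forall>x\<in>S. (1::int) = 0"
      using S(2) unfolding int_independent_def by (elim allE[of _ "\<lambda>_. 1"]) simp
    with \<open>S \<noteq> {}\<close> show False by simp
  qed
  then have "abelian_rank G \<le> 0"
    unfolding abelian_rank_def by (intro SUP_least) (auto simp: zero_enat_def)
  then show ?thesis by simp
qed

text \<open>Two different elements $z^j$, $z^k$ are never independent, because
  $(z^j)^k (z^k)^{-j} = 1$.\<close>

lemma abelian_rank_infinite_cyclic: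
  fixes G (structure)
  assumes "comm_group G" and z: "z \<in> carrier G"
    and gen: "\<And>x. x \<in> carrier G \<Longrightarrow> \<exists>k::int. x = z [^]\<^bsub>G\<^esub> k"
    and inf: "\<And>k::int. z [^]\<^bsub>G\<^esub> k = \<one>\<^bsub>G\<^esub> \<Longrightarrow> k = 0"
  shows "abelian_rank G = 1"
proof (rule antisym)
  interpret comm_group G by fact
  show "abelian_rank G \<le> 1"
    unfolding abelian_rank_def
  proof (rule SUP_least)
    fix S assume "S \<in> {S. finite S \<and> S \<subseteq> carrier G \<and> int_independent G S}"
    then have S: "finite S" "S \<subseteq> carrier G" "int_independent G S" by auto
    have "x = y" if "x \<in> S" "y \<in> S" for x y
    proof (rule ccontr)
      assume "x \<noteq> y"
      have "x \<in> carrier G" "y \<in> carrier G" using that S(2) by blast+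
      from gen[OF this(1)] gen[OF this(2)] obtain j k :: int where jk: "x = z [^] j" "y = z [^] k"
        by (elim exE)
      define c where "c = (\<lambda>u. if u = x then k else if u = y then - j else 0)"
      have "finprod G (\<lambda>u. u [^] c u) S = finprod G (\<lambda>u. u [^] c u) {x, y}"
        by (rule finprod_mono_neutral_cong_right) (use S that in \<open>auto simp: c_def\<close>)
      also have "\<dots> = x [^] k \<otimes> y [^] (- j)"
        using \<open>x \<noteq> y\<close> S(2) that
        by (subst finprod_insert) (auto simp: c_def intro!: m_comm)
      also have "\<dots> = z [^] (j * k + k * (- j))"
        unfolding jk int_pow_pow[OF z] int_pow_mult[OF z] ..
      also have "\<dots> = \<one>" by (simp add: mult.commute)
      finally have "\<forall>u\<in>S. c u = 0" using S(3) unfolding int_independent_def by blast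
      then have "k = 0" "j = 0" using that \<open>x \<noteq> y\<close> by (auto simp: c_def split: if_splits)
      with jk \<open>x \<noteq> y\<close> show False by simp
    qed
    then have "card S \<le> 1" using S(1) by (simp add: card_le_Suc0_iff_eq)
    then show "enat (card S) \<le> 1" by (simp add: one_enat_def)
  qed
  have "int_independent G {z}"
    unfolding int_independent_def using z inf by (auto simp: finprod_singleton)
  then have "enat (card {z}) \<le> abelian_rank G"
    unfolding abelian_rank_def using z by (intro SUP_upper) auto
  then show "1 \<le> abelian_rank G" by (simp add: one_enat_def)
qed


section \<open>The simplicial boundary\<close>

text \<open>The incidence number $[s : a]$ of the algebraic topology literature.\<close>

definition incidence :: "'a::linorder set \<Rightarrow> 'a set \<Rightarrow> int" where
  "incidence s a = Poly_Mapping.lookup (simplicial_boundary (frag_of s)) a"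

lemma simplicial_boundary_add: "simplicial_boundary (c + c') = simplicial_boundary c + simplicial_boundary c'"
  and simplicial_boundary_diff: "simplicial_boundary (c - c') = simplicial_boundary c - simplicial_boundary c'"
  and simplicial_boundary_cmul: "simplicial_boundary (frag_cmul k c) = frag_cmul k (simplicial_boundary c)"
  and simplicial_boundary_0: "simplicial_boundary 0 = 0"
  by (simp_all add: simplicial_boundary_def frag_extend_add frag_extend_diff frag_extend_cmul)

lemma simplicial_boundary_sum:
  "finite A \<Longrightarrow> simplicial_boundary (\<Sum>i\<in>A. f i) = (\<Sum>i\<in>A. simplicial_boundary (f i))"
  by (simp add: simplicial_boundary_def frag_extend_sum)

lemma simplicial_boundary_frag_of:
  "simplicial_boundary (frag_of s) = (\<Sum>v\<in>s. frag_cmul ((-1) ^ card {u \<in> s. u < v}) (frag_of (s - {v})))"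
  by (simp add: simplicial_boundary_def)

lemma simplicial_boundary_expand:
  "simplicial_boundary c =
     (\<Sum>s\<in>Poly_Mapping.keys c. frag_cmul (Poly_Mapping.lookup c s) (simplicial_boundary (frag_of s)))"
  by (simp add: simplicial_boundary_def frag_extend_def[of _ c])

lemma lookup_simplicial_boundary:
  "Poly_Mapping.lookup (simplicial_boundary c) a =
     (\<Sum>s\<in>Poly_Mapping.keys c. Poly_Mapping.lookup c s * incidence s a)"
  by (simp add: simplicial_boundary_expand[of c] lookup_sum incidence_def)

lemma incidence_face:
  assumes "finite s" and "v \<in> s"
  shows "incidence s (s - {v}) = (-1) ^ card {u \<in> s. u < v}"
proof -
  have "incidence s (s - {v}) =
      (\<Sum>w\<in>s. (-1) ^ card {u \<in> s. u < w} * (if w = v then 1 else 0))"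
    unfolding incidence_def simplicial_boundary_frag_of lookup_sum
    by (rule sum.cong) (use assms in auto)
  then show ?thesis using assms by (simp add: if_distrib cong: if_cong)
qed

lemma incidence_nonzero_imp_face:
  assumes "incidence s a \<noteq> 0"
  obtains v where "v \<in> s" and "a = s - {v}"
proof -
  have "\<exists>v\<in>s. a = s - {v}"
  proof (rule ccontr)
    assume "\<not> (\<exists>v\<in>s. a = s - {v})"
    then have "incidence s a = 0"
      unfolding incidence_def simplicial_boundary_frag_of lookup_sum by (intro sum.neutral) auto
    with assms show False by simp
  qed
  with that show thesis by blast
qed

text \<open>In the iterated boundary of a simplex $s$ the face $s \setminus \{v, w\}$ arises twice, by
  removing $v$ or $w$ first. The sign of the larger vertex changes when the smaller one has been
  removed before, so the two contributions cancel.\<close>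

lemma simplicial_boundary_boundary:
  assumes "\<And>s. s \<in> Poly_Mapping.keys c \<Longrightarrow> finite s"
  shows "simplicial_boundary (simplicial_boundary c) = 0"
proof -
  have single: "simplicial_boundary (simplicial_boundary (frag_of s)) = 0"
    if fin: "finite s" for s :: "'a set"
  proof -
    define sg where "sg = (\<lambda>v. (-1 :: int) ^ card {u \<in> s. u < v})"
    define f where "f = (\<lambda>v w. frag_cmul (sg v * sg w) (frag_of (s - {v, w})))"
    have f_sym: "f v w = f w v" for v w
      by (simp add: f_def mult.commute insert_commute)
    \<comment> \<open>Removing \<open>v\<close> flips the sign of the vertices above \<open>v\<close> and of no others.\<close>
    have face: "frag_cmul (sg v) (simplicial_boundary (frag_of (s - {v}))) =
        (\<Sum>w\<in>{w \<in> s. w < v}. f v w) - (\<Sum>w\<in>{w \<in> s. v < w}. f v w)" if "v \<in> s" for v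
    proof -
      have lo: "{u \<in> s - {v}. u < w} = {u \<in> s. u < w}" if "w < v" for w
        using that by auto
      have hi: "(-1 :: int) ^ card {u \<in> s - {v}. u < w} = - sg w" if "v < w" for w
      proof -
        have "{u \<in> s. u < w} = insert v {u \<in> s - {v}. u < w}" using that \<open>v \<in> s\<close> by auto
        then have "card {u \<in> s. u < w} = Suc (card {u \<in> s - {v}. u < w})" using fin by simp
        then show ?thesis by (simp add: sg_def)
      qed
      have split: "sum g (s - {v}) = sum g {w \<in> s. w < v} + sum g {w \<in> s. v < w}"
        for g :: "'a \<Rightarrow> 'a set \<Rightarrow>\<^sub>0 int"
      proof -
        have "s - {v} = {w \<in> s. w < v} \<union> {w \<in> s. v < w}" by auto
        moreover have "{w \<in> s. w < v} \<inter> {w \<in> s. v < w} = {}" by auto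
        ultimately show ?thesis using fin by (simp add: sum.union_disjoint)
      qed
      have set2: "s - {v} - {w} = s - {v, w}" for w by auto
      have "frag_cmul (sg v) (simplicial_boundary (frag_of (s - {v}))) =
          (\<Sum>w\<in>s - {v}. frag_cmul (sg v * (-1) ^ card {u \<in> s - {v}. u < w}) (frag_of (s - {v, w})))"
        unfolding simplicial_boundary_frag_of frag_cmul_sum frag_cmul_cmul set2 ..
      also have "\<dots> = (\<Sum>w\<in>{w \<in> s. w < v}. frag_cmul (sg v * (-1) ^ card {u \<in> s - {v}. u < w}) (frag_of (s - {v, w})))
          + (\<Sum>w\<in>{w \<in> s. v < w}. frag_cmul (sg v * (-1) ^ card {u \<in> s - {v}. u < w}) (frag_of (s - {v, w})))"
        by (rule split)
      also have "(\<Sum>w\<in>{w \<in> s. w < v}. frag_cmul (sg v * (-1) ^ card {u \<in> s - {v}. u < w}) (frag_of (s - {v, w})))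
          = (\<Sum>w\<in>{w \<in> s. w < v}. f v w)"
      proof (rule sum.cong)
        fix w assume "w \<in> {w \<in> s. w < v}"
        then show "frag_cmul (sg v * (-1) ^ card {u \<in> s - {v}. u < w}) (frag_of (s - {v, w})) = f v w"
          by (simp only: mem_Collect_eq lo f_def sg_def)
      qed simp
      also have "(\<Sum>w\<in>{w \<in> s. v < w}. frag_cmul (sg v * (-1) ^ card {u \<in> s - {v}. u < w}) (frag_of (s - {v, w})))
          = (\<Sum>w\<in>{w \<in> s. v < w}. - f v w)"
      proof (rule sum.cong)
        fix w assume "w \<in> {w \<in> s. v < w}"
        then have "v < w" by simp
        show "frag_cmul (sg v * (-1) ^ card {u \<in> s - {v}. u < w}) (frag_of (s - {v, w})) = - f v w"
          unfolding hi[OF \<open>v < w\<close>] f_def by simp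
      qed simp
      finally show ?thesis by (simp add: sum_negf)
    qed
    have "simplicial_boundary (simplicial_boundary (frag_of s)) =
        (\<Sum>v\<in>s. frag_cmul (sg v) (simplicial_boundary (frag_of (s - {v}))))"
      unfolding simplicial_boundary_frag_of[of s] simplicial_boundary_sum[OF fin]
        simplicial_boundary_cmul sg_def ..
    also have "\<dots> = (\<Sum>v\<in>s. \<Sum>w\<in>{w \<in> s. w < v}. f v w) - (\<Sum>v\<in>s. \<Sum>w\<in>{w \<in> s. v < w}. f v w)"
      by (simp add: face sum_subtractf)
    also have "(\<Sum>v\<in>s. \<Sum>w\<in>{w \<in> s. w < v}. f v w) = (\<Sum>w\<in>s. \<Sum>v\<in>{v \<in> s. w < v}. f v w)"
      by (rule sum.swap_restrict) (use fin in auto)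
    also have "\<dots> = (\<Sum>v\<in>s. \<Sum>w\<in>{w \<in> s. v < w}. f v w)"
      by (intro sum.cong refl) (rule f_sym)
    finally show ?thesis by simp
  qed
  have "simplicial_boundary (simplicial_boundary c) =
      (\<Sum>s\<in>Poly_Mapping.keys c. frag_cmul (Poly_Mapping.lookup c s)
         (simplicial_boundary (simplicial_boundary (frag_of s))))"
    by (simp only: simplicial_boundary_expand[of c] simplicial_boundary_sum finite_keys
        simplicial_boundary_cmul)
  also have "\<dots> = 0" by (intro sum.neutral) (simp add: assms single)
  finally show ?thesis .
qed


section \<open>Ranks of reduced homology groups\<close>

definition simplicial_complex :: "'a set set \<Rightarrow> bool" where
  "simplicial_complex K \<longleftrightarrow> (\<forall>s\<in>K. finite s \<and> Pow s \<subseteq> K)"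

lemma simplicial_complex_face: "simplicial_complex K \<Longrightarrow> s \<in> K \<Longrightarrow> t \<subseteq> s \<Longrightarrow> t \<in> K"
  by (auto simp: simplicial_complex_def)

lemma simplicial_chain_iff:
  "c \<in> carrier (simplicial_chain_group K p) \<longleftrightarrow> Poly_Mapping.keys c \<subseteq> simplices K p"
  by (simp add: simplicial_chain_group_def)

lemma simplicial_boundary_chain:
  assumes complex: "simplicial_complex K"
    and c: "Poly_Mapping.keys c \<subseteq> simplices K (p + 1)"
  shows "Poly_Mapping.keys (simplicial_boundary c) \<subseteq> simplices K p"
proof
  fix a assume "a \<in> Poly_Mapping.keys (simplicial_boundary c)"
  then have "(\<Sum>s\<in>Poly_Mapping.keys c. Poly_Mapping.lookup c s * incidence s a) \<noteq> 0"
    by (simp add: in_keys_iff lookup_simplicial_boundary)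
  then obtain s where "s \<in> Poly_Mapping.keys c" "incidence s a \<noteq> 0"
    by (auto elim: sum.not_neutral_contains_not_neutral)
  then obtain v where "s \<in> simplices K (p + 1)" "v \<in> s" "a = s - {v}"
    using c by (metis incidence_nonzero_imp_face subsetD)
  then have s: "s \<in> K" "finite s" "int (card s) = p + 2" and a: "a \<subseteq> s" "finite a"
    by (auto simp: simplices_def)
  have "card s = Suc (card a)" using card.remove[OF s(2) \<open>v \<in> s\<close>] \<open>a = s - {v}\<close> by simp
  with s(3) have "int (card a) = p + 1" by simp
  with simplicial_complex_face[OF complex s(1) a(1)] a(2) show "a \<in> simplices K p"
    by (simp add: simplices_def)
qed

lemma simplicial_cycles_iff:
  "c \<in> simplicial_cycles K p \<longleftrightarrow>
     Poly_Mapping.keys c \<subseteq> simplices K p \<and> simplicial_boundary c = 0"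
  by (simp add: simplicial_cycles_def simplicial_chain_iff)

lemma simplicial_boundaries_iff:
  "b \<in> simplicial_boundaries K p \<longleftrightarrow>
     (\<exists>e. Poly_Mapping.keys e \<subseteq> simplices K (p + 1) \<and> b = simplicial_boundary e)"
  by (simp add: simplicial_boundaries_def simplicial_chain_group_def image_iff Bex_def)

lemma simplicial_boundaries_subset_cycles:
  assumes "simplicial_complex K"
  shows "simplicial_boundaries K p \<subseteq> simplicial_cycles K p"
proof
  fix b assume "b \<in> simplicial_boundaries K p"
  then obtain e where e: "Poly_Mapping.keys e \<subseteq> simplices K (p + 1)" "b = simplicial_boundary e"
    by (auto simp: simplicial_boundaries_iff)
  have "finite s" if "s \<in> Poly_Mapping.keys e" for s
    using e(1) that by (auto simp: simplices_def)
  then have "simplicial_boundary b = 0" unfolding e(2) by (rule simplicial_boundary_boundary)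
  with simplicial_boundary_chain[OF assms e(1)] e(2) show "b \<in> simplicial_cycles K p"
    by (simp add: simplicial_cycles_iff)
qed

lemma subgroup_simplicial_cycles: "subgroup (simplicial_cycles K p) (simplicial_chain_group K p)"
proof -
  interpret group "simplicial_chain_group K p" by (simp add: simplicial_chain_group_def)
  show ?thesis
  proof (rule subgroupI)
    show "simplicial_cycles K p \<noteq> {}"
      using simplicial_cycles_iff[of 0 K p] by (auto simp: simplicial_boundary_0)
  next
    fix c c' assume "c \<in> simplicial_cycles K p" "c' \<in> simplicial_cycles K p"
    then show "c \<otimes>\<^bsub>simplicial_chain_group K p\<^esub> c' \<in> simplicial_cycles K p"
      using keys_add[of c c']
      by (auto simp: simplicial_cycles_iff simplicial_chain_group_def simplicial_boundary_add)
  next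
    fix c assume "c \<in> simplicial_cycles K p"
    then show "inv\<^bsub>simplicial_chain_group K p\<^esub> c \<in> simplicial_cycles K p"
      using simplicial_boundary_cmul[of "-1" c]
      by (auto simp: simplicial_cycles_iff simplicial_chain_group_def keys_minus)
  qed (auto simp: simplicial_cycles_def)
qed

text \<open>The homology group is a quotient of two nested auxiliary groups; this describes them on the level
  of chains, so that ranks can be computed with cycles and boundaries.\<close>

lemma homology_as_quotient:
  fixes K :: "'a::linorder set set" and p :: int
  assumes complex: "simplicial_complex K"
  defines "Z \<equiv> subgroup_generated (simplicial_chain_group K p) (simplicial_cycles K p)"
  shows "carrier Z = simplicial_cycles K p"
    and "simplicial_boundaries K p \<lhd> Z"
    and "comm_group (reduced_simplicial_homology K p)"
    and "\<And>c (k::int). c \<in> simplicial_cycles K p \<Longrightarrow> c [^]\<^bsub>Z\<^esub> k = frag_cmul k c"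
    and "mult Z = (+)"
proof -
  interpret A: comm_group "simplicial_chain_group K p"
    by (simp add: simplicial_chain_group_def abelian_free_Abelian_group)
  interpret Z: comm_group Z
    unfolding Z_def by (rule A.abelian_subgroup_generated) (rule A.comm_group_axioms)
  show car: "carrier Z = simplicial_cycles K p"
    unfolding Z_def by (rule subgroup.carrier_subgroup_generated_subgroup[OF subgroup_simplicial_cycles])
  show mult: "mult Z = (+)"
    by (auto simp: Z_def simplicial_chain_group_def free_Abelian_group_def)
  have "subgroup (simplicial_boundaries K p) (simplicial_chain_group K p)"
  proof (rule A.subgroupI)
    show "simplicial_boundaries K p \<subseteq> carrier (simplicial_chain_group K p)"
      using simplicial_boundaries_subset_cycles[OF complex, of p] by (auto simp: simplicial_cycles_def)
    have "simplicial_boundary 0 \<in> simplicial_boundaries K p"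
      unfolding simplicial_boundaries_iff by (intro exI[of _ 0]) simp
    then show "simplicial_boundaries K p \<noteq> {}" by blast
  next
    fix b b' assume b: "b \<in> simplicial_boundaries K p" "b' \<in> simplicial_boundaries K p"
    then obtain e e' where "Poly_Mapping.keys e \<subseteq> simplices K (p + 1)" "b = simplicial_boundary e"
      "Poly_Mapping.keys e' \<subseteq> simplices K (p + 1)" "b' = simplicial_boundary e'"
      by (auto simp: simplicial_boundaries_iff)
    then show "b \<otimes>\<^bsub>simplicial_chain_group K p\<^esub> b' \<in> simplicial_boundaries K p"
      using keys_add[of e e'] unfolding simplicial_boundaries_iff
      by (intro exI[of _ "e + e'"]) (auto simp: simplicial_chain_group_def simplicial_boundary_add)
  next
    fix b assume b: "b \<in> simplicial_boundaries K p"
    then obtain e where e: "Poly_Mapping.keys e \<subseteq> simplices K (p + 1)" "b = simplicial_boundary e"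
      by (auto simp: simplicial_boundaries_iff)
    have "inv\<^bsub>simplicial_chain_group K p\<^esub> b = - b"
      using simplicial_boundary_chain[OF complex e(1)] e(2) by (simp add: simplicial_chain_group_def)
    then show "inv\<^bsub>simplicial_chain_group K p\<^esub> b \<in> simplicial_boundaries K p"
      using e simplicial_boundary_cmul[of "-1" e] unfolding simplicial_boundaries_iff
      by (intro exI[of _ "- e"]) (auto simp: keys_minus)
  qed
  with simplicial_boundaries_subset_cycles[OF complex] have sub: "subgroup (simplicial_boundaries K p) Z"
    unfolding Z_def by (intro A.subgroup_of_subgroup_generated)
  then show "simplicial_boundaries K p \<lhd> Z" by (simp add: Z.normal_iff_subgroup)
  show "comm_group (reduced_simplicial_homology K p)"
    unfolding reduced_simplicial_homology_def using Z.abelian_FactGroup[OF sub] by (simp add: Z_def)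
  show "c [^]\<^bsub>Z\<^esub> k = frag_cmul k c" if "c \<in> simplicial_cycles K p" for c and k :: int
  proof -
    have "c [^]\<^bsub>Z\<^esub> k = c [^]\<^bsub>simplicial_chain_group K p\<^esub> k"
      unfolding Z_def by (rule A.int_pow_subgroup_generated) (use that car Z_def in simp)
    also have "\<dots> = frag_cmul k c"
      using that by (simp add: simplicial_chain_group_def simplicial_cycles_iff)
    finally show ?thesis .
  qed
qed

lemma homology_rank_0_if_cycles_bound:
  assumes complex: "simplicial_complex K"
    and bd: "simplicial_cycles K p \<subseteq> simplicial_boundaries K p"
  shows "abelian_rank (reduced_simplicial_homology K p) = 0"
proof -
  define Z where "Z = subgroup_generated (simplicial_chain_group K p) (simplicial_cycles K p)"
  note facts = homology_as_quotient[OF complex, where p = p, folded Z_def]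
  interpret N: normal "simplicial_boundaries K p" Z using facts(2) by blast
  interpret H: comm_group "reduced_simplicial_homology K p" using facts(3) by blast
  have H: "reduced_simplicial_homology K p = Z Mod simplicial_boundaries K p"
    by (simp add: reduced_simplicial_homology_def Z_def)
  have "simplicial_boundaries K p #>\<^bsub>Z\<^esub> c = simplicial_boundaries K p" if "c \<in> carrier Z" for c
    using that bd facts(1) by (intro N.rcos_const[OF N.is_group]) auto
  then have "carrier (Z Mod simplicial_boundaries K p) \<subseteq> {simplicial_boundaries K p}"
    by (auto simp: carrier_FactGroup)
  then show ?thesis
    using H.one_closed facts(3) by (intro abelian_rank_trivial) (auto simp: H)
qed

lemma homology_rank_1_if_infinite_cyclic:
  assumes complex: "simplicial_complex K"
    and z: "z \<in> simplicial_cycles K p"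
    and gen: "\<And>c. c \<in> simplicial_cycles K p \<Longrightarrow> \<exists>k. c - frag_cmul k z \<in> simplicial_boundaries K p"
    and inf: "\<And>k. frag_cmul k z \<in> simplicial_boundaries K p \<Longrightarrow> k = 0"
  shows "abelian_rank (reduced_simplicial_homology K p) = 1"
proof -
  define Z where "Z = subgroup_generated (simplicial_chain_group K p) (simplicial_cycles K p)"
  let ?B = "simplicial_boundaries K p"
  note facts = homology_as_quotient[OF complex, where p = p, folded Z_def]
  interpret N: normal ?B Z using facts(2) by blast
  have H: "reduced_simplicial_homology K p = Z Mod ?B"
    by (simp add: reduced_simplicial_homology_def Z_def)
  have zZ: "z \<in> carrier Z" using z facts(1) by simp
  have pow: "(?B #>\<^bsub>Z\<^esub> z) [^]\<^bsub>Z Mod ?B\<^esub> k = ?B #>\<^bsub>Z\<^esub> frag_cmul k z" for k :: int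
    using N.FactGroup_int_pow[OF zZ, of k] facts(4)[OF z] by simp
  have powZ: "frag_cmul k z \<in> carrier Z" for k
    using N.int_pow_closed[OF zZ, of k] facts(4)[OF z] by simp
  show ?thesis
    unfolding H
  proof (rule abelian_rank_infinite_cyclic)
    show "comm_group (Z Mod ?B)" using facts(3) H by simp
    show "?B #>\<^bsub>Z\<^esub> z \<in> carrier (Z Mod ?B)" using zZ by (simp add: carrier_FactGroup)
  next
    fix x assume "x \<in> carrier (Z Mod ?B)"
    then obtain c where c: "c \<in> carrier Z" "x = ?B #>\<^bsub>Z\<^esub> c" by (auto simp: carrier_FactGroup)
    then obtain k where k: "c - frag_cmul k z \<in> ?B" using gen facts(1) by auto
    have "c = (c - frag_cmul k z) \<otimes>\<^bsub>Z\<^esub> frag_cmul k z" by (simp add: facts(5))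
    then have "c \<in> ?B #>\<^bsub>Z\<^esub> frag_cmul k z"
      using k by (auto simp: r_coset_def)
    then have "x = ?B #>\<^bsub>Z\<^esub> frag_cmul k z"
      using c(2) N.repr_independence[OF _ powZ N.subgroup_axioms] by simp
    then show "\<exists>k::int. x = (?B #>\<^bsub>Z\<^esub> z) [^]\<^bsub>Z Mod ?B\<^esub> k" using pow by blast
  next
    fix k :: int
    assume "(?B #>\<^bsub>Z\<^esub> z) [^]\<^bsub>Z Mod ?B\<^esub> k = \<one>\<^bsub>Z Mod ?B\<^esub>"
    then have "?B #>\<^bsub>Z\<^esub> frag_cmul k z = ?B" by (simp add: pow)
    then have "frag_cmul k z \<in> ?B"
      using N.coset_join1[OF _ powZ N.subgroup_axioms] by simp
    then show "k = 0" by (rule inf)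
  qed
qed


section \<open>Acyclic matchings with at most one critical cell\<close>

text \<open>The index drops along every gradient path, so no such path returns to its start.\<close>

lemma acyclic_matching_if_index:
  fixes h :: "'a::order \<Rightarrow> nat"
  assumes pm: "partial_matching P M"
    and mono: "\<And>a b a' b'. (a, b) \<in> M \<Longrightarrow> (a', b') \<in> M \<Longrightarrow> a \<noteq> a' \<Longrightarrow> covered_in P a b' \<Longrightarrow> h a < h a'"
  shows "acyclic_matching P M"
  unfolding acyclic_matching_def
proof (intro conjI notI pm)
  have partner: "(a, partner M a) \<in> M" if "a \<in> Domain M" for a
  proof -
    from that obtain b where b: "(a, b) \<in> M" by (elim DomainE)
    have "b' = b" if "(a, b') \<in> M" for b'
      using pm b that unfolding partial_matching_def by fastforce
    then have "partner M a = b" unfolding partner_def using b by blast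
    with b show ?thesis by simp
  qed
  assume "\<exists>as. matching_cycle P M as"
  then obtain as where as: "length as \<ge> 2" "distinct as" "set as \<subseteq> Domain M"
    and cov: "\<And>i. i < length as \<Longrightarrow> covered_in P (as ! i) (partner M (as ! (Suc i mod length as)))"
    unfolding matching_cycle_def by blast
  have less: "h (as ! i) < h (as ! (Suc i mod length as))" if "i < length as" for i
  proof -
    let ?j = "Suc i mod length as"
    have j: "?j < length as" using as(1) by (intro mod_less_divisor) linarith
    have "?j \<noteq> i" using as(1) that by (simp add: mod_Suc)
    then have "as ! i \<noteq> as ! ?j" using as(2) that j by (simp add: nth_eq_iff_index_eq)
    moreover have "as ! i \<in> Domain M" "as ! ?j \<in> Domain M" using as(3) that j by auto
    ultimately show ?thesis using mono[OF partner partner _ cov[OF that]] by blast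
  qed
  have "set as \<noteq> {}" using as(1) by auto
  then have "Max (h ` set as) \<in> h ` set as" by (intro Max_in) auto
  then obtain a where "a \<in> set as" "h a = Max (h ` set as)" by fastforce
  then have a: "a \<in> set as" "\<forall>b\<in>set as. h b \<le> h a" by auto
  then obtain i where i: "i < length as" "a = as ! i" by (metis in_set_conv_nth)
  have "as ! (Suc i mod length as) \<in> set as"
    using as(1) by (intro nth_mem mod_less_divisor) linarith
  with less[OF i(1)] a(2) i(2) show False by (simp add: leD)
qed

lemma covered_in_complex_imp_insert:
  assumes complex: "simplicial_complex K" and cov: "covered_in K a b"
  obtains v where "v \<notin> a" and "b = insert v a"
proof -
  from cov have K: "b \<in> K" and ab: "a \<subset> b" and min: "\<not> (\<exists>c\<in>K. a \<subset> c \<and> c \<subset> b)"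
    by (auto simp: covered_in_def)
  from ab obtain v where v: "v \<in> b" "v \<notin> a" by blast
  then have "insert v a \<subseteq> b" using ab by blast
  with simplicial_complex_face[OF complex K] min v have "insert v a = b" by blast
  with v that show thesis by blast
qed

text \<open>An acyclic matching in which acyclicity is witnessed by an index that drops along gradient paths.
  A step of such a path leads from $a'$ to a face $a \neq a'$ of its partner. It is described by
  inserting a vertex instead of by the covering relation, so that the condition does not mention
  the complex and passes to subcomplexes.\<close>

locale indexed_matching =
  fixes K :: "'a::linorder set set" and M :: "('a set \<times> 'a set) set" and h :: "'a set \<Rightarrow> nat"
  assumes complex: "simplicial_complex K"
    and matching: "partial_matching K M"
    and index_less: "\<And>a b a' b' v. (a, b) \<in> M \<Longrightarrow> (a', b') \<in> M \<Longrightarrow> a \<noteq> a' \<Longrightarrow> v \<notin> a \<Longrightarrow>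
       b' = insert v a \<Longrightarrow> h a < h a'"
begin

lemma finite_simplex: "s \<in> K \<Longrightarrow> finite s"
  using complex by (simp add: simplicial_complex_def)

lemma matched_covered: "(a, b) \<in> M \<Longrightarrow> covered_in K a b"
  using matching by (auto simp: partial_matching_def)

lemma matched_insert:
  assumes "(a, b) \<in> M" obtains v where "v \<notin> a" and "b = insert v a"
  using covered_in_complex_imp_insert[OF complex matched_covered[OF assms]] that .

lemma matched_in: "(a, b) \<in> M \<Longrightarrow> a \<in> K \<and> b \<in> K"
  using matched_covered by (simp add: covered_in_def)

lemma matched_overlap:
  assumes "x \<in> K" "e \<in> M" "e' \<in> M" "x \<in> {fst e, snd e}" "x \<in> {fst e', snd e'}"
  shows "e = e'"
proof -
  have "\<forall>x\<in>K. \<forall>e\<in>M. \<forall>e'\<in>M. x \<in> {fst e, snd e} \<longrightarrow> x \<in> {fst e', snd e'} \<longrightarrow> e = e'"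
    using matching by (simp add: partial_matching_def)
  from this[rule_format, OF assms] show ?thesis .
qed

lemma matched_upper_unique:
  assumes "(a, b) \<in> M" and "(a, b') \<in> M"
  shows "b = b'"
  using matched_overlap[OF _ assms, of a] matched_in[OF assms(1)] by simp

lemma acyclic: "acyclic_matching K M"
proof (rule acyclic_matching_if_index[OF matching, of h])
  fix a b a' b' assume M: "(a, b) \<in> M" "(a', b') \<in> M" "a \<noteq> a'" and cov: "covered_in K a b'"
  obtain v where "v \<notin> a" "b' = insert v a"
    using complex cov by (rule covered_in_complex_imp_insert)
  then show "h a < h a'" by (rule index_less[OF M])
qed

lemma incidence_matched:
  assumes "(a, b) \<in> M" shows "incidence b a * incidence b a = 1"
proof -
  obtain v where v: "v \<notin> a" "b = insert v a" using assms by (rule matched_insert)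
  then have "a = b - {v}" "v \<in> b" by auto
  moreover have "finite b" using assms matched_in finite_simplex by blast
  ultimately show ?thesis by (simp add: incidence_face flip: power_add)
qed

lemma index_less_if_incidence:
  assumes "(a, b) \<in> M" "(a', b') \<in> M" "a \<noteq> a'" "incidence b' a \<noteq> 0"
  shows "h a < h a'"
proof -
  obtain v where "v \<in> b'" "a = b' - {v}" using assms(4) by (rule incidence_nonzero_imp_face)
  then have "v \<notin> a" "b' = insert v a" by auto
  then show ?thesis using index_less assms by blast
qed

text \<open>A lower face $a$ of maximal index is removed by subtracting a multiple of the boundary of its
  partner: the coefficient of $a$ there is $\pm 1$, and every other lower face in this boundary has a
  smaller index. All faces of maximal index can therefore be removed at the same time without
  interfering with each other, and the bound \<open>m\<close> on the indices drops.\<close>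

lemma homologous_to_chain_without_lower_cells:
  assumes c: "Poly_Mapping.keys c \<subseteq> simplices K p"
    and bound: "\<And>a. a \<in> Poly_Mapping.keys c \<Longrightarrow> a \<in> Domain M \<Longrightarrow> h a < m"
  shows "\<exists>e. Poly_Mapping.keys e \<subseteq> simplices K (p + 1) \<and>
    Poly_Mapping.keys (c - simplicial_boundary e) \<inter> Domain M = {}"
  using assms
proof (induction m arbitrary: c)
  case 0
  then show ?case by (intro exI[of _ 0]) (auto simp: simplicial_boundary_0)
next
  case (Suc m)
  define A where "A = {a \<in> Poly_Mapping.keys c. a \<in> Domain M \<and> h a = m}"
  have finA: "finite A" by (simp add: A_def)
  define \<mu> where "\<mu> a = (SOME b. (a, b) \<in> M)" for a
  have \<mu>: "(a, \<mu> a) \<in> M" if "a \<in> Domain M" for a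
    using that unfolding \<mu>_def by (meson DomainE someI)
  \<comment> \<open>The incidence number is \<open>1\<close> or \<open>-1\<close>, so multiplying by it is the same as dividing.\<close>
  define k where "k a = Poly_Mapping.lookup c a * incidence (\<mu> a) a" for a
  define e where "e = (\<Sum>a\<in>A. frag_cmul (k a) (frag_of (\<mu> a)))"
  have "\<mu> a \<in> simplices K (p + 1)" if "a \<in> A" for a
  proof -
    from that have a: "(a, \<mu> a) \<in> M" "a \<in> simplices K p" using \<mu> Suc.prems(1) by (auto simp: A_def)
    obtain v where "v \<notin> a" "\<mu> a = insert v a" using a(1) by (rule matched_insert)
    then show ?thesis using a matched_in[OF a(1)] by (auto simp: simplices_def)
  qed
  then have "(\<Union>a\<in>A. Poly_Mapping.keys (frag_cmul (k a) (frag_of (\<mu> a)))) \<subseteq> simplices K (p + 1)"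
    by (auto simp: keys_frag_of split: if_splits)
  then have e: "Poly_Mapping.keys e \<subseteq> simplices K (p + 1)"
    unfolding e_def using keys_sum by (rule order_trans[rotated])
  let ?c = "c - simplicial_boundary e"
  have lookup_e: "Poly_Mapping.lookup (simplicial_boundary e) a = (\<Sum>x\<in>A. k x * incidence (\<mu> x) a)" for a
    unfolding e_def simplicial_boundary_sum[OF finA]
    by (simp add: lookup_sum simplicial_boundary_cmul incidence_def)
  have keys_c: "Poly_Mapping.keys ?c \<subseteq> simplices K p"
    using keys_diff[of c "simplicial_boundary e"] Suc.prems(1) simplicial_boundary_chain[OF complex e]
    by blast
  have less: "h a < m" if a: "a \<in> Poly_Mapping.keys ?c" "a \<in> Domain M" for a
  proof (rule ccontr)
    assume "\<not> h a < m"
    have "incidence (\<mu> x) a = 0" if "x \<in> A" "x \<noteq> a" for x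
      using index_less_if_incidence[OF \<mu>[OF a(2)] \<mu>, of x] that \<open>\<not> h a < m\<close> by (auto simp: A_def)
    then have "Poly_Mapping.lookup (simplicial_boundary e) a =
        (\<Sum>x\<in>A. if x = a then k a * incidence (\<mu> a) a else 0)"
      unfolding lookup_e by (intro sum.cong) auto
    also have "\<dots> = (if a \<in> A then k a * incidence (\<mu> a) a else 0)" using finA by simp
    also have "\<dots> = (if a \<in> A then Poly_Mapping.lookup c a else 0)"
      using incidence_matched[OF \<mu>[OF a(2)]] by (simp add: k_def mult.assoc)
    also have "\<dots> = Poly_Mapping.lookup c a"
      using a(2) Suc.prems(2)[of a] \<open>\<not> h a < m\<close> by (auto simp: A_def in_keys_iff less_Suc_eq)
    finally have "Poly_Mapping.lookup ?c a = 0" by (simp add: lookup_minus)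
    with a(1) show False by (simp add: in_keys_iff)
  qed
  from Suc.IH[OF keys_c less] obtain e' where e': "Poly_Mapping.keys e' \<subseteq> simplices K (p + 1)"
    "Poly_Mapping.keys (?c - simplicial_boundary e') \<inter> Domain M = {}" by blast
  have "?c - simplicial_boundary e' = c - simplicial_boundary (e + e')"
    by (simp add: simplicial_boundary_add)
  moreover have "Poly_Mapping.keys (e + e') \<subseteq> simplices K (p + 1)"
    using keys_add[of e e'] e e'(1) by blast
  ultimately show ?case using e'(2) by metis
qed

text \<open>Take an upper face $b$ of the cycle whose lower partner $a$ has maximal index. Any other upper face
  of the cycle above $a$ would have a partner of larger index, so nothing cancels the contribution
  of $b$ to the coefficient of $a$ in the boundary.\<close>

lemma cycle_on_upper_cells_eq_0:
  assumes keys: "Poly_Mapping.keys c \<subseteq> Range M" and cycle: "simplicial_boundary c = 0"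
  shows "c = 0"
proof (rule ccontr)
  assume "c \<noteq> 0"
  define A where "A = {a. \<exists>b\<in>Poly_Mapping.keys c. (a, b) \<in> M}"
  have "Poly_Mapping.keys c \<noteq> {}" using \<open>c \<noteq> 0\<close> by simp
  then have "A \<noteq> {}" using keys by (fastforce simp: A_def)
  moreover have "A \<subseteq> (\<Union>b\<in>Poly_Mapping.keys c. Pow b)"
    using matched_insert by (auto simp: A_def; blast)
  moreover have "finite (\<Union>b\<in>Poly_Mapping.keys c. Pow b)"
    using keys matched_in finite_simplex by fastforce
  ultimately have "finite (h ` A)" "h ` A \<noteq> {}" using finite_subset by blast+
  then have "Max (h ` A) \<in> h ` A" and le_Max: "\<And>x. x \<in> A \<Longrightarrow> h x \<le> Max (h ` A)" by auto
  then obtain a where "a \<in> A" "h a = Max (h ` A)" by fastforce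
  with le_Max have max: "\<And>x. x \<in> A \<Longrightarrow> h x \<le> h a" by simp
  from \<open>a \<in> A\<close> obtain b where b: "b \<in> Poly_Mapping.keys c" "(a, b) \<in> M" by (auto simp: A_def)
  have "incidence s a = 0" if s: "s \<in> Poly_Mapping.keys c" "s \<noteq> b" for s
  proof (rule ccontr)
    assume inc: "incidence s a \<noteq> 0"
    obtain x where x: "(x, s) \<in> M" using s(1) keys by blast
    then have "x \<noteq> a" using matched_upper_unique[OF b(2)] s(2) by auto
    then have "h a < h x" using index_less_if_incidence[OF b(2) x _ inc] by simp
    moreover have "h x \<le> h a" using max x s(1) by (auto simp: A_def)
    ultimately show False by simp
  qed
  then have "Poly_Mapping.lookup (simplicial_boundary c) a =
      (\<Sum>s\<in>Poly_Mapping.keys c. if s = b then Poly_Mapping.lookup c b * incidence b a else 0)"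
    unfolding lookup_simplicial_boundary by (intro sum.cong) auto
  also have "\<dots> = Poly_Mapping.lookup c b * incidence b a" using b(1) by simp
  also have "\<dots> \<noteq> 0" using b(1) incidence_matched[OF b(2)] by (auto simp: in_keys_iff)
  finally show False using cycle by simp
qed

lemma cycles_bound_if_no_critical:
  assumes "critical K M = {}"
  shows "simplicial_cycles K p \<subseteq> simplicial_boundaries K p"
proof
  fix c assume "c \<in> simplicial_cycles K p"
  then have c: "Poly_Mapping.keys c \<subseteq> simplices K p" "simplicial_boundary c = 0"
    by (auto simp: simplicial_cycles_iff)
  define m where "m = Suc (Max (h ` Poly_Mapping.keys c))"
  have "h a < m" if "a \<in> Poly_Mapping.keys c" for a
    using that by (simp add: m_def less_Suc_eq_le)
  then obtain e where e: "Poly_Mapping.keys e \<subseteq> simplices K (p + 1)"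
    "Poly_Mapping.keys (c - simplicial_boundary e) \<inter> Domain M = {}"
    using homologous_to_chain_without_lower_cells[OF c(1)] by blast
  have "Poly_Mapping.keys (c - simplicial_boundary e) \<subseteq> simplices K p"
    using keys_diff[of c "simplicial_boundary e"] c(1) simplicial_boundary_chain[OF complex e(1)]
    by blast
  then have keys_K: "Poly_Mapping.keys (c - simplicial_boundary e) \<subseteq> K" by (auto simp: simplices_def)
  have "Poly_Mapping.keys (c - simplicial_boundary e) \<subseteq> Range M"
  proof
    fix s assume s: "s \<in> Poly_Mapping.keys (c - simplicial_boundary e)"
    then have "s \<in> K" "s \<notin> critical K M" "s \<notin> Domain M" using keys_K assms e(2) by auto
    then show "s \<in> Range M" by (auto simp: critical_def)
  qed
  moreover have "\<And>s. s \<in> Poly_Mapping.keys e \<Longrightarrow> finite s" using e(1) by (auto simp: simplices_def)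
  then have "simplicial_boundary (simplicial_boundary e) = 0" by (rule simplicial_boundary_boundary)
  then have "simplicial_boundary (c - simplicial_boundary e) = 0"
    by (simp add: simplicial_boundary_diff c(2))
  ultimately have "c - simplicial_boundary e = 0" by (rule cycle_on_upper_cells_eq_0)
  then show "c \<in> simplicial_boundaries K p" using e(1) by (auto simp: simplicial_boundaries_iff)
qed

theorem perfect_if_no_critical:
  assumes "critical K M = {}"
  shows "perfect_acyclic_matching K M"
  using homology_rank_0_if_cycles_bound[OF complex cycles_bound_if_no_critical[OF assms]] acyclic assms
  by (simp add: perfect_acyclic_matching_def simplices_def zero_enat_def)

text \<open>The facet $\sigma$ can be removed without destroying the complex, and what remains has no critical
  face. Thus every cycle that avoids $\sigma$ bounds.\<close>

theorem perfect_if_critical_facet: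
  assumes crit: "critical K M = {\<sigma>}" and facet: "\<And>s. s \<in> K \<Longrightarrow> \<not> \<sigma> \<subset> s"
  shows "perfect_acyclic_matching K M"
proof -
  define L where "L = K - {\<sigma>}"
  have \<sigma>: "\<sigma> \<in> K" "finite \<sigma>" using crit finite_simplex by (auto simp: critical_def)
  have sub_L: "M \<subseteq> L \<times> L"
    using crit matched_in by (fastforce simp: critical_def L_def)
  interpret L: indexed_matching L M h
  proof
    show "simplicial_complex L"
      unfolding simplicial_complex_def
    proof (intro ballI conjI subsetI)
      fix s assume "s \<in> L"
      then have s: "s \<in> K" "s \<noteq> \<sigma>" by (auto simp: L_def)
      show "finite s" using s(1) by (rule finite_simplex)
      fix t assume "t \<in> Pow s"
      then have "t \<in> K" using simplicial_complex_face[OF complex s(1)] by simp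
      moreover have "t \<noteq> \<sigma>" using facet[OF s(1)] s(2) \<open>t \<in> Pow s\<close> by auto
      ultimately show "t \<in> L" by (simp add: L_def)
    qed
  next
    show "partial_matching L M"
      unfolding partial_matching_def
    proof (intro conjI sub_L)
      show "\<forall>(a, b)\<in>M. covered_in L a b"
        using matched_covered sub_L by (auto simp: covered_in_def L_def)
      show "\<forall>x\<in>L. \<forall>e\<in>M. \<forall>e'\<in>M. x \<in> {fst e, snd e} \<longrightarrow> x \<in> {fst e', snd e'} \<longrightarrow> e = e'"
        unfolding L_def by (intro ballI impI) (rule matched_overlap, auto)
    qed
  qed (fact index_less)
  have "critical L M = {}" using crit by (simp add: critical_def L_def) blast
  note L_bound = L.cycles_bound_if_no_critical[OF this]
  \<comment> \<open>The dimension of the critical facet.\<close>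
  define q where "q = int (card \<sigma>) - 1"
  have simp_L: "simplices L p = simplices K p - {\<sigma>}" for p by (auto simp: simplices_def L_def)
  have \<sigma>_q: "\<sigma> \<in> simplices K p \<longleftrightarrow> p = q" for p using \<sigma> by (auto simp: simplices_def q_def)
  have L_le: "simplicial_boundaries L p \<subseteq> simplicial_boundaries K p" for p
  proof
    fix b assume "b \<in> simplicial_boundaries L p"
    then obtain e where "Poly_Mapping.keys e \<subseteq> simplices L (p + 1)" "b = simplicial_boundary e"
      unfolding simplicial_boundaries_iff by (elim exE conjE)
    then show "b \<in> simplicial_boundaries K p"
      unfolding simplicial_boundaries_iff simp_L by (intro exI[of _ e]) blast
  qed
  \<comment> \<open>Only the coefficient of the facet can obstruct a cycle from being a boundary.\<close>
  have cyc_L: "c \<in> simplicial_boundaries K p"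
    if "c \<in> simplicial_cycles K p" "Poly_Mapping.lookup c \<sigma> = 0" for c p
  proof -
    have "c \<in> simplicial_cycles L p"
      using that by (auto simp: simplicial_cycles_iff simp_L in_keys_iff)
    then show ?thesis using L_bound L_le by blast
  qed
  have rank0: "abelian_rank (reduced_simplicial_homology K p) = 0" if "p \<noteq> q" for p
  proof (rule homology_rank_0_if_cycles_bound[OF complex])
    show "simplicial_cycles K p \<subseteq> simplicial_boundaries K p"
    proof
      fix c assume c: "c \<in> simplicial_cycles K p"
      then have "Poly_Mapping.lookup c \<sigma> = 0"
        using that \<sigma>_q[of p] by (auto simp: simplicial_cycles_iff in_keys_iff)
      with c show "c \<in> simplicial_boundaries K p" by (rule cyc_L)
    qed
  qed
  have bd_\<sigma>: "Poly_Mapping.keys (simplicial_boundary (frag_of \<sigma>)) \<subseteq> simplices K (q - 1)"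
    by (rule simplicial_boundary_chain[OF complex]) (simp_all add: keys_frag_of \<sigma>_q)
  then have "simplicial_boundary (frag_of \<sigma>) \<in> simplicial_cycles L (q - 1)"
    unfolding simplicial_cycles_iff simp_L
    using \<sigma>_q[of "q - 1"] \<sigma>(2) by (auto intro: simplicial_boundary_boundary simp: keys_frag_of)
  then obtain e where e: "Poly_Mapping.keys e \<subseteq> simplices L q"
    "simplicial_boundary (frag_of \<sigma>) = simplicial_boundary e"
    using L_bound[of "q - 1"] unfolding subset_eq simplicial_boundaries_iff by auto
  \<comment> \<open>The generating cycle: a chain of the smaller complex fills the hole left by the facet.\<close>
  define z where "z = frag_of \<sigma> - e"
  have z\<sigma>: "Poly_Mapping.lookup z \<sigma> = 1"
    using e(1) by (auto simp: z_def lookup_minus simp_L in_keys_iff)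
  have z: "z \<in> simplicial_cycles K q"
    unfolding simplicial_cycles_iff z_def
    using keys_diff[of "frag_of \<sigma>" e] e \<sigma>_q[of q]
    by (auto simp: simplicial_boundary_diff keys_frag_of simp_L)
  have rank1: "abelian_rank (reduced_simplicial_homology K q) = 1"
  proof (rule homology_rank_1_if_infinite_cyclic[OF complex z])
    fix c assume c: "c \<in> simplicial_cycles K q"
    let ?k = "Poly_Mapping.lookup c \<sigma>"
    have "c - frag_cmul ?k z \<in> simplicial_cycles K q"
      using c z keys_diff[of c "frag_cmul ?k z"] keys_cmul[of ?k z]
      by (auto simp: simplicial_cycles_iff simplicial_boundary_diff simplicial_boundary_cmul)
    then have "c - frag_cmul ?k z \<in> simplicial_boundaries K q"
      by (rule cyc_L) (simp add: lookup_minus z\<sigma>)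
    then show "\<exists>k. c - frag_cmul k z \<in> simplicial_boundaries K q" by blast
  next
    fix k assume "frag_cmul k z \<in> simplicial_boundaries K q"
    then obtain f where f: "Poly_Mapping.keys f \<subseteq> simplices K (q + 1)"
      "frag_cmul k z = simplicial_boundary f" by (auto simp: simplicial_boundaries_iff)
    \<comment> \<open>No face lies above the facet, so it does not occur in any boundary.\<close>
    have "incidence s \<sigma> = 0" if "s \<in> Poly_Mapping.keys f" for s
    proof (rule ccontr)
      assume "incidence s \<sigma> \<noteq> 0"
      then have "\<sigma> \<subset> s" by (auto elim: incidence_nonzero_imp_face)
      then show False using facet f(1) that by (auto simp: simplices_def)
    qed
    then have "Poly_Mapping.lookup (simplicial_boundary f) \<sigma> = 0"
      by (simp add: lookup_simplicial_boundary)
    then show "k = 0" using z\<sigma> by (simp flip: f(2))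
  qed
  have crit_p: "simplices {\<sigma>} p = (if p = q then {\<sigma>} else {})" for p
    using \<sigma>(2) by (auto simp: simplices_def q_def)
  show ?thesis
    unfolding perfect_acyclic_matching_def crit crit_p
    using acyclic rank0 rank1 by (simp add: zero_enat_def one_enat_def)
qed

end


section \<open>The matching on the complex of the path\<close>

text \<open>The union of the first \<open>k\<close> blocks $\{di+2,\dots,di+d-1\}$, described by residues: membership of a
  vertex and restriction to an initial segment are then read off without searching for the
  block.\<close>

definition blocks :: "nat \<Rightarrow> nat \<Rightarrow> nat set" where
  "blocks d k = {x. x < d * k \<and> 2 \<le> x mod d}"

lemma blocks_eq_Union:
  assumes "k \<ge> 1"
  shows "blocks d k = (\<Union>i\<in>{0..k - 1}. {d * i + 2..d * i + d - 1})"
proof (cases "d = 0")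
  case True
  then show ?thesis by (auto simp: blocks_def)
next
  case False
  show ?thesis
  proof (intro equalityI subsetI)
    fix x assume "x \<in> blocks d k"
    then have x: "x < d * k" "2 \<le> x mod d" by (auto simp: blocks_def)
    define i r where "i = x div d" and "r = x mod d"
    have "i < k" using x(1) by (simp add: i_def less_mult_imp_div_less mult.commute)
    moreover have "x = d * i + r" "r < d" "2 \<le> r" using False x(2) by (simp_all add: i_def r_def)
    ultimately show "x \<in> (\<Union>i\<in>{0..k - 1}. {d * i + 2..d * i + d - 1})"
      by (intro UN_I[of i]) auto
  next
    fix x assume "x \<in> (\<Union>i\<in>{0..k - 1}. {d * i + 2..d * i + d - 1})"
    then obtain i where i: "i \<le> k - 1" "d * i + 2 \<le> x" "x \<le> d * i + d - 1" by auto
    then obtain r where r: "x = d * i + r" "2 \<le> r" "r < d"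
      by (intro that[of "x - d * i"]) auto
    have "d * Suc i \<le> d * k" using i(1) assms by (intro mult_le_mono2) simp
    with r show "x \<in> blocks d k" by (simp add: blocks_def)
  qed
qed

lemma block_subset_blocks:
  assumes "i < k" shows "{d * i + 2..<d * i + d} \<subseteq> blocks d k"
proof
  fix x assume "x \<in> {d * i + 2..<d * i + d}"
  then obtain r where r: "x = d * i + r" "2 \<le> r" "r < d"
    by (intro that[of "x - d * i"]) auto
  have "d * Suc i \<le> d * k" using assms by (intro mult_le_mono2) simp
  with r show "x \<in> blocks d k" by (simp add: blocks_def)
qed

lemma blocks_pos: "x \<in> blocks d k \<Longrightarrow> 1 \<le> x"
  by (cases x) (simp_all add: blocks_def)

locale path_complex =
  fixes d n :: nat
  assumes d: "d \<ge> 3" and n: "n \<ge> 1"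
begin

definition K :: "nat set set" where "K = Ind (d - 2) (path_graph n)"

lemma K_iff: "a \<in> K \<longleftrightarrow> a \<subseteq> {1..n} \<and> (\<nexists>x. {x..<x + d - 1} \<subseteq> a)"
proof -
  have "{x..x + (d - 2)} = {x..<x + d - 1}" for x using d by auto
  then show ?thesis by (simp add: K_def in_Ind_path_graph_iff)
qed

lemma complex_K: "simplicial_complex K"
  unfolding simplicial_complex_def
proof (intro ballI conjI subsetI)
  fix s assume s: "s \<in> K"
  then show "finite s" unfolding K_iff by (meson finite_atLeastAtMost finite_subset)
  fix t assume "t \<in> Pow s"
  with s show "t \<in> K" unfolding K_iff Pow_iff by (meson order_trans)
qed

text \<open>The index \<open>i\<close> is the first one at which adding $di+1$ does not leave the complex: that all
  earlier attempts fail is expressed by the prefix of \<open>a\<close>. The condition does not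
  depend on whether $di+1$ belongs to \<open>a\<close>, so both partners satisfy it for the same \<open>i\<close>.\<close>

definition toggles :: "nat \<Rightarrow> nat set \<Rightarrow> bool" where
  "toggles i a \<longleftrightarrow> insert (d * i + 1) a \<in> K \<and> a \<inter> {1..d * i} = blocks d i"

definition M :: "(nat set \<times> nat set) set" where
  "M = {(a, insert (d * i + 1) a) | a i. toggles i a \<and> d * i + 1 \<notin> a}"

lemma insert_run_notin_K:
  assumes "{d * i + 2..<d * i + d} \<subseteq> a" shows "insert (d * i + 1) a \<notin> K"
proof
  assume "insert (d * i + 1) a \<in> K"
  then have "\<not> {d * i + 1..<d * i + 1 + d - 1} \<subseteq> insert (d * i + 1) a" unfolding K_iff by blast
  moreover have "{d * i + 1..<d * i + 1 + d - 1} \<subseteq> insert (d * i + 1) {d * i + 2..<d * i + d}" by auto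
  ultimately show False using assms by blast
qed

text \<open>If $i < j$, then the prefix demanded by $j$ contains the block after $di+1$, and adding $di+1$ would
  complete a forbidden run.\<close>

lemma toggles_unique:
  assumes "toggles i a" and "toggles j a" shows "i = j"
proof -
  have False if "toggles i a" "toggles j a" "i < j" for i j
  proof -
    have "{d * i + 2..<d * i + d} \<subseteq> a"
      using block_subset_blocks[OF that(3), of d] that(2) by (auto simp: toggles_def)
    then show False using insert_run_notin_K that(1) by (simp add: toggles_def)
  qed
  then show ?thesis using assms by (meson linorder_neqE_nat)
qed

lemma toggles_insert: "toggles i (insert (d * i + 1) a) \<longleftrightarrow> toggles i a"
  by (simp add: toggles_def)

lemma M_cases:
  assumes "(a, b) \<in> M"
  obtains i where "toggles i a" "toggles i b" "d * i + 1 \<notin> a" "b = insert (d * i + 1) a"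
proof -
  from assms obtain i where "toggles i a" "d * i + 1 \<notin> a" "b = insert (d * i + 1) a"
    unfolding M_def by blast
  then show thesis using that[of i] toggles_insert by simp
qed

lemma toggles_imp_matched:
  assumes "toggles i a" shows "a \<in> Domain M \<union> Range M"
proof (cases "d * i + 1 \<in> a")
  case True
  let ?a = "a - {d * i + 1}"
  have "insert (d * i + 1) ?a = a" using True by blast
  moreover have "toggles i ?a"
    using assms toggles_insert[of i ?a] unfolding \<open>insert (d * i + 1) ?a = a\<close> by blast
  ultimately have "(?a, a) \<in> M" unfolding M_def by force
  then show ?thesis by blast
next
  case False
  then have "(a, insert (d * i + 1) a) \<in> M" using assms by (auto simp: M_def)
  then show ?thesis by blast
qed

lemma partial_matching_M: "partial_matching K M"
proof -
  have cov: "covered_in K a b" if "(a, b) \<in> M" for a b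
  proof -
    obtain i where i: "toggles i a" "toggles i b" "d * i + 1 \<notin> a" "b = insert (d * i + 1) a"
      using \<open>(a, b) \<in> M\<close> by (rule M_cases)
    then have "b \<in> K" by (simp add: toggles_def)
    moreover have "a \<in> K" using simplicial_complex_face[OF complex_K \<open>b \<in> K\<close>] i(4) by blast
    ultimately show ?thesis using i(3,4) by (auto simp: covered_in_def)
  qed
  have unique: "e = e'" if M: "e \<in> M" "e' \<in> M" and x: "x \<in> {fst e, snd e}" "x \<in> {fst e', snd e'}" for x e e'
  proof -
    obtain a b a' b' where e: "e = (a, b)" "e' = (a', b')" by fastforce
    obtain i where i: "toggles i a" "toggles i b" "d * i + 1 \<notin> a" "b = insert (d * i + 1) a"
      using M(1) unfolding e(1) by (rule M_cases)
    obtain j where j: "toggles j a'" "toggles j b'" "d * j + 1 \<notin> a'" "b' = insert (d * j + 1) a'"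
      using M(2) unfolding e(2) by (rule M_cases)
    have "toggles i x" "toggles j x" using x i j by (auto simp: e)
    then have "i = j" by (rule toggles_unique)
    have "a = x - {d * i + 1}" "a' = x - {d * j + 1}" using x i j by (auto simp: e)
    with \<open>i = j\<close> i(4) j(4) show ?thesis by (simp add: e)
  qed
  show ?thesis
    unfolding partial_matching_def
  proof (intro conjI ballI impI)
    show "M \<subseteq> K \<times> K" using cov by (auto simp: covered_in_def)
    show "case e of (a, b) \<Rightarrow> covered_in K a b" if "e \<in> M" for e using that cov by auto
  qed (rule unique)
qed

definition index :: "nat set \<Rightarrow> nat" where "index a = (THE i. toggles i a)"

lemma index_eq: "toggles i a \<Longrightarrow> index a = i"
  unfolding index_def using toggles_unique by blast

text \<open>Let $a$ be obtained from the partner $a' \cup \{dj+1\}$ of $a'$ by removing another vertex. Then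
  $dj+1 \in a$. If the index $i$ of $a$ were larger than $j$, then the prefix of $a$ would consist of
  blocks, which avoid $dj+1$; and $i = j$ is excluded since $di+1 \notin a$.\<close>

sublocale indexed_matching K M index
proof
  fix a b a' b' v
  assume M: "(a, b) \<in> M" "(a', b') \<in> M" and ne: "a \<noteq> a'" and v: "v \<notin> a" "b' = insert v a"
  obtain i where i: "toggles i a" "d * i + 1 \<notin> a" using M(1) by (elim M_cases)
  obtain j where j: "toggles j a'" "d * j + 1 \<notin> a'" "b' = insert (d * j + 1) a'"
    using M(2) by (elim M_cases)
  have "v \<noteq> d * j + 1"
  proof
    assume "v = d * j + 1"
    moreover have "a = b' - {v}" "a' = b' - {d * j + 1}" using v j(2,3) by blast+
    ultimately show False using ne by simp
  qed
  with v j(3) have ja: "d * j + 1 \<in> a" by auto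
  with i(2) have "i \<noteq> j" by blast
  moreover have "\<not> j < i"
  proof
    assume "j < i"
    then have "d * Suc j \<le> d * i" by (intro mult_le_mono2) simp
    then have "d * j + 1 \<in> a \<inter> {1..d * i}" using ja d by simp
    then have "d * j + 1 \<in> blocks d i" using i(1) unfolding toggles_def by blast
    then show False using mod_mult_self4[of d j 1] d by (simp add: blocks_def)
  qed
  ultimately show "index a < index a'" using index_eq[OF i(1)] index_eq[OF j(1)] by simp
qed (rule complex_K partial_matching_M)+

lemma critical_iff: "a \<in> critical K M \<longleftrightarrow> a \<in> K \<and> (\<forall>i. \<not> toggles i a)"
proof
  assume "a \<in> critical K M"
  then have "a \<in> K" "a \<notin> Domain M \<union> Range M" by (auto simp: critical_def)
  with toggles_imp_matched show "a \<in> K \<and> (\<forall>i. \<not> toggles i a)" by blast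
next
  assume a: "a \<in> K \<and> (\<forall>i. \<not> toggles i a)"
  show "a \<in> critical K M"
    unfolding critical_def
  proof (intro CollectI conjI ballI)
    fix e assume "e \<in> M"
    obtain x y where e: "e = (x, y)" by fastforce
    obtain i where "toggles i x" "toggles i y" using \<open>e \<in> M\<close> unfolding e by (elim M_cases)
    then show "case e of (x, y) \<Rightarrow> a \<noteq> x \<and> a \<noteq> y" using a by (auto simp: e)
  qed (use a in blast)
qed

text \<open>As $di+1$ cannot be added, it belongs to a run of $d-1$ vertices of $a \cup \{di+1\}$. This run
  cannot start earlier, since $di \notin a$, so it is $\{di+1,\dots,di+d-1\}$. As $a$ itself
  contains no run, both neighbours $di+1$ and $di+d$ of the block are missing.\<close>

lemma critical_prefix_step:
  assumes a: "a \<in> critical K M" and pre: "a \<inter> {1..d * i} = blocks d i" and "d * i < n"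
  shows "a \<inter> {1..d * Suc i} = blocks d (Suc i)" and "d * i + d - 1 \<le> n"
proof -
  have aK: "a \<in> K" and "insert (d * i + 1) a \<notin> K"
    using a pre by (auto simp: critical_iff toggles_def)
  moreover have sub: "insert (d * i + 1) a \<subseteq> {1..n}"
    using aK \<open>d * i < n\<close> by (auto simp: K_iff)
  ultimately obtain x where x: "{x..<x + d - 1} \<subseteq> insert (d * i + 1) a" unfolding K_iff by blast
  have no_run: "\<not> {y..<y + d - 1} \<subseteq> a" for y using aK unfolding K_iff by blast
  with x have in_run: "d * i + 1 \<in> {x..<x + d - 1}" by blast
  have "\<not> x \<le> d * i"
  proof
    assume "x \<le> d * i"
    then have "d * i \<in> {x..<x + d - 1}" using in_run by simp
    with x have "d * i \<in> insert (d * i + 1) a" by blast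
    then have "d * i \<in> a" "d * i \<in> {1..n}" using sub by (simp, blast)
    then have "d * i \<in> a \<inter> {1..d * i}" by simp
    then have "d * i \<in> blocks d i" unfolding pre .
    then show False by (simp add: blocks_def)
  qed
  with in_run have "x = d * i + 1" by simp
  with x have run: "{d * i + 1..<d * i + d} \<subseteq> insert (d * i + 1) a" by simp
  moreover have "{d * i + 2..<d * i + d} \<subseteq> {d * i + 1..<d * i + d} - {d * i + 1}" by auto
  ultimately have block: "{d * i + 2..<d * i + d} \<subseteq> a" by blast
  have "d * i + d - 1 \<in> {d * i + 1..<d * i + d}" using d by auto
  with run sub have "d * i + d - 1 \<in> {1..n}" by blast
  then show "d * i + d - 1 \<le> n" by simp
  have first: "d * i + 1 \<notin> a"
    using insert_run_notin_K[OF block] aK by (metis insert_absorb)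
  have last: "d * i + d \<notin> a"
  proof
    assume "d * i + d \<in> a"
    have "{d * i + 2..<d * i + 2 + d - 1} \<subseteq> insert (d * i + d) {d * i + 2..<d * i + d}" by auto
    with \<open>d * i + d \<in> a\<close> block no_run[of "d * i + 2"] show False by blast
  qed
  have low: "y \<in> a \<longleftrightarrow> y \<in> blocks d (Suc i)" if "y \<in> {1..d * i}" for y
  proof -
    have "y \<in> a \<longleftrightarrow> y \<in> blocks d i" using pre that by blast
    also have "\<dots> \<longleftrightarrow> y \<in> blocks d (Suc i)"
      using that by (cases "y = d * i") (auto simp: blocks_def)
    finally show ?thesis .
  qed
  have high: "d * i + r \<in> a \<longleftrightarrow> d * i + r \<in> blocks d (Suc i)" if r: "1 \<le> r" "r \<le> d" for r
  proof -
    consider "r = 1" | "2 \<le> r" "r < d" | "r = d" using r by linarith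
    then show ?thesis
    proof cases
      case 1
      then show ?thesis using first mod_mult_self4[of d i 1] d by (simp add: blocks_def)
    next
      case 2
      then have "d * i + r \<in> a" using block by auto
      with 2 show ?thesis by (simp add: blocks_def)
    next
      case 3
      then show ?thesis using last by (simp add: blocks_def)
    qed
  qed
  show "a \<inter> {1..d * Suc i} = blocks d (Suc i)"
  proof (intro equalityI subsetI)
    fix y assume y: "y \<in> a \<inter> {1..d * Suc i}"
    show "y \<in> blocks d (Suc i)"
    proof (cases "y \<le> d * i")
      case True
      then show ?thesis using low[of y] y by auto
    next
      case False
      then show ?thesis using high[of "y - d * i"] y by auto
    qed
  next
    fix y assume y: "y \<in> blocks d (Suc i)"
    then have "1 \<le> y" "y < d * Suc i" using blocks_pos[OF y] by (simp_all add: blocks_def)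
    show "y \<in> a \<inter> {1..d * Suc i}"
    proof (cases "y \<le> d * i")
      case True
      then show ?thesis using low[of y] y \<open>1 \<le> y\<close> by auto
    next
      case False
      then show ?thesis using high[of "y - d * i"] y \<open>y < d * Suc i\<close> by auto
    qed
  qed
qed

lemma critical_imp_blocks:
  assumes a: "a \<in> critical K M"
  obtains k where "k \<ge> 1" "n = d * k \<or> n = d * k - 1" "a = blocks d k"
proof -
  \<comment> \<open>The last prefix step that is possible reaches the end of the path.\<close>
  define k where "k = (LEAST k. n \<le> d * k)"
  have "n \<le> d * n" using d by simp
  then have nk: "n \<le> d * k" unfolding k_def by (rule LeastI)
  have less: "d * i < n" if "i < k" for i
    using that not_less_Least unfolding k_def by (metis not_le)
  have pre: "i \<le> k \<Longrightarrow> a \<inter> {1..d * i} = blocks d i" for i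
  proof (induction i)
    case 0
    then show ?case by (simp add: blocks_def)
  next
    case (Suc i)
    then show ?case using critical_prefix_step(1)[OF a _ less] by simp
  qed
  have "a \<subseteq> {1..n}" using a by (auto simp: critical_iff K_iff)
  then have "a = a \<inter> {1..d * k}" using nk by auto
  then have "a = blocks d k" using pre by simp
  have "k \<noteq> 0" using nk n by (intro notI) simp
  then obtain i where k: "k = Suc i" by (cases k) auto
  then have "d * i + d - 1 \<le> n" using critical_prefix_step(2)[OF a pre less] by simp
  then have "n = d * k \<or> n = d * k - 1" using nk by (auto simp: k)
  with \<open>k \<noteq> 0\<close> \<open>a = blocks d k\<close> show thesis by (intro that[of k]) auto
qed

lemma blocks_critical:
  assumes "k \<ge> 1" and nk: "n = d * k \<or> n = d * k - 1"
  shows "blocks d k \<in> critical K M"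
proof -
  have "n \<le> d * k" "d * k \<le> n + 1" using nk by auto
  have no_run: "\<not> {x..<x + d - 1} \<subseteq> blocks d k" for x
  proof (cases "2 \<le> x mod d")
    case True
    have "x mod d < d" using d by simp
    \<comment> \<open>The next multiple of \<open>d\<close> is reached within the run, as \<open>x\<close> has residue at least two.\<close>
    have "(x + (d - x mod d)) mod d = 0"
      by (metis \<open>x mod d < d\<close> add_diff_inverse_nat mod_add_left_eq mod_self not_less_iff_gr_or_eq)
    then have "x + (d - x mod d) \<notin> blocks d k" by (simp add: blocks_def)
    moreover have "x + (d - x mod d) \<in> {x..<x + d - 1}" using True \<open>x mod d < d\<close> by auto
    ultimately show ?thesis by blast
  next
    case False
    then have "x \<notin> blocks d k" by (simp add: blocks_def)
    moreover have "x \<in> {x..<x + d - 1}" using d by simp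
    ultimately show ?thesis by blast
  qed
  have "blocks d k \<subseteq> {1..n}"
    using \<open>d * k \<le> n + 1\<close> blocks_pos[of _ d k] by (force simp: blocks_def)
  with no_run have "blocks d k \<in> K" by (simp add: K_iff)
  moreover have "\<not> toggles i (blocks d k)" for i
  proof
    assume t: "toggles i (blocks d k)"
    then have "d * i + 1 \<le> n" by (auto simp: toggles_def K_iff)
    with \<open>n \<le> d * k\<close> have "d * i < d * k" by linarith
    then have "i < k" by simp
    from insert_run_notin_K[OF block_subset_blocks[OF this]] t show False by (simp add: toggles_def)
  qed
  ultimately show ?thesis by (simp add: critical_iff)
qed

text \<open>A vertex outside the blocks is $di+1$ or $di+d$ for some $i < k$; either one completes the block
  between them to a forbidden run.\<close>

lemma blocks_facet:
  assumes nk: "n = d * k \<or> n = d * k - 1" and s: "s \<in> K"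
  shows "\<not> blocks d k \<subset> s"
proof
  assume "blocks d k \<subset> s"
  then obtain y where y: "y \<in> s" "y \<notin> blocks d k" and sub: "blocks d k \<subseteq> s" by blast
  have "1 \<le> y" "y \<le> n" using s y(1) by (auto simp: K_iff)
  then have "y \<le> d * k" using nk by linarith
  define i where "i = y div d"
  have y_eq: "y = d * i + y mod d" by (simp add: i_def)
  have "y mod d \<le> 1" using y(2) \<open>y \<le> d * k\<close> by (cases "y = d * k") (auto simp: blocks_def)
  then consider "y mod d = 1" | "y mod d = 0" by linarith
  then show False
  proof cases
    case 1
    then have "y = d * i + 1" using y_eq by simp
    then have "d * i < d * k" using \<open>y \<le> d * k\<close> by linarith
    then have "i < k" by simp
    have "insert (d * i + 1) s \<notin> K"
      using block_subset_blocks[OF \<open>i < k\<close>] sub by (intro insert_run_notin_K) blast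
    then show False using s y(1) \<open>y = d * i + 1\<close> by (simp add: insert_absorb)
  next
    case 2
    then have "y = d * i" using y_eq by simp
    then obtain j where "i = Suc j" using \<open>1 \<le> y\<close> by (cases i) auto
    then have "y = d * j + d" using \<open>y = d * i\<close> by simp
    then have "d * j < d * k" using \<open>y \<le> d * k\<close> d by linarith
    then have "j < k" by simp
    have "{d * j + 2..<d * j + 2 + d - 1} \<subseteq> insert y {d * j + 2..<d * j + d}"
      using \<open>y = d * j + d\<close> by auto
    then have "{d * j + 2..<d * j + 2 + d - 1} \<subseteq> s"
      using block_subset_blocks[OF \<open>j < k\<close>] sub y(1) by blast
    then show False using s unfolding K_iff by blast
  qed
qed

lemma critical_eq:
  assumes "k \<ge> 1" and nk: "n = d * k \<or> n = d * k - 1"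
  shows "critical K M = {blocks d k}"
proof (intro equalityI subsetI)
  fix a assume "a \<in> critical K M"
  then obtain j where j: "j \<ge> 1" "n = d * j \<or> n = d * j - 1" "a = blocks d j"
    by (rule critical_imp_blocks)
  \<comment> \<open>Different values of \<open>d * k\<close> are at least three apart, so \<open>n\<close> determines \<open>k\<close>.\<close>
  have "\<not> d * Suc j \<le> d * k" "\<not> d * Suc k \<le> d * j"
    using j(1,2) assms d by auto
  then have "j = k" by (metis Suc_leI linorder_neqE_nat mult_le_mono2)
  with j show "a \<in> {blocks d k}" by simp
qed (use blocks_critical[OF assms] in simp)

lemma critical_empty:
  assumes "\<nexists>k. k \<ge> 1 \<and> (n = d * k \<or> n = d * k - 1)"
  shows "critical K M = {}"
  using assms critical_imp_blocks by blast

end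

theorem proposition4p3:
  fixes d n :: nat
  assumes "d \<ge> 3" and "n \<ge> 1"
  shows "\<exists>M. perfect_acyclic_matching (Ind (d - 2) (path_graph n)) M \<and>
    (\<forall>k \<ge> 1. n = d * k \<or> n = d * k - 1 \<longrightarrow>
       critical (Ind (d - 2) (path_graph n)) M = {\<Union>i \<in> {0..k - 1}. {d * i + 2..d * i + d - 1}}) \<and>
    ((\<nexists>k. k \<ge> 1 \<and> (n = d * k \<or> n = d * k - 1)) \<longrightarrow>
       critical (Ind (d - 2) (path_graph n)) M = {})"
proof -
  interpret path_complex d n using assms by unfold_locales
  have "perfect_acyclic_matching K M"
  proof (cases "\<exists>k. k \<ge> 1 \<and> (n = d * k \<or> n = d * k - 1)")
    case True
    then obtain k where k: "k \<ge> 1" "n = d * k \<or> n = d * k - 1" by blast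
    show ?thesis
      using critical_eq[OF k] blocks_facet[OF k(2)] by (rule perfect_if_critical_facet)
  next
    case False
    then show ?thesis by (intro perfect_if_no_critical critical_empty)
  qed
  then show ?thesis
    using critical_eq critical_empty unfolding K_def[symmetric]
    by (intro exI[of _ M]) (auto simp: blocks_eq_Union)
qed

end
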